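(* Let $p>5$ be a prime. Then $$\sum_{k=0}^{[p/4]}\frac{\binom{4k}{2k}}{(-16)^k}\equiv\begin{cases}(-1)^{\frac{p-1}8}2^{\frac{p-1}4}\pmod p&\text{if }p\equiv1\pmod 8,\\ (-1)^{\frac{p-3}8}2^{\frac{p-3}4}\pmod p&\text{if }p\equiv3\pmod8,\\ 0\pmod p&\text{if }p\equiv5\pmod 8,\\ (-1)^{\frac{p+1}8}2^{\frac{p-3}4}\pmod p&\text{if }p\equiv7\pmod8.\end{cases}$$
   Context: $[x]$ is the greatest integer not exceeding $x$. *)

theory Defs
  imports Complex_Main "HOL-Number_Theory.Number_Theory"
begin

text \<open>The ring of rational \<open>p\<close>-integers, i.e. \<open>\<int>\<close> localised at the prime \<open>p\<close>.\<close>

definition p_integers :: "nat \<Rightarrow> rat set" where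
  "p_integers p = {of_int a / of_int b | a b. b \<noteq> 0 \<and> \<not> int p dvd b}"

text \<open>Congruences between rational numbers are taken in that ring.\<close>

definition rat_cong :: "rat \<Rightarrow> rat \<Rightarrow> nat \<Rightarrow> bool"
    (\<open>(\<open>indent=1\<close>[_ \<equiv> _] '(mod\<^sub>\<rat> _'))\<close>) where
  "[x \<equiv> y] (mod\<^sub>\<rat> p) \<longleftrightarrow>
     x \<in> p_integers p \<and> y \<in> p_integers p \<and> (\<exists>z \<in> p_integers p. x - y = of_nat p * z)"

end

theory Submission
  imports Defs
begin

text \<open>
  Put \<open>n = (p - 1) / 2\<close>. Since \<open>n\<close> is \<open>- 1 / 2\<close> modulo \<open>p\<close>, the central binomial coefficient
  \<open>(2 j) choose j\<close> is congruent to \<open>(- 4) ^ j * (n choose j)\<close> for all \<open>j \<le> n\<close>. With \<open>j = 2 k\<close> the sum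
  becomes the alternating sum of the \<open>n choose (2 k)\<close>, which is the real part of \<open>(1 + \<i>) ^ n\<close>;
  this is read off from \<open>(1 + \<i>) ^ 4 = - 4\<close>.
\<close>

lemma of_int_in_p_integers:
  assumes "prime p"
  shows "of_int a \<in> p_integers p"
proof -
  have "of_int a = of_int a / (of_int 1 :: rat)" "\<not> int p dvd 1"
    using assms by auto
  then show ?thesis unfolding p_integers_def using one_neq_zero by blast
qed

lemma p_integers_add:
  assumes "prime p" "x \<in> p_integers p" "y \<in> p_integers p"
  shows "x + y \<in> p_integers p"
proof -
  obtain a b where x: "x = of_int a / of_int b" "b \<noteq> 0" "\<not> int p dvd b"
    using assms(2) by (auto simp: p_integers_def)
  obtain c d where y: "y = of_int c / of_int d" "d \<noteq> 0" "\<not> int p dvd d"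
    using assms(3) by (auto simp: p_integers_def)
  have "x + y = of_int (a * d + c * b) / of_int (b * d)"
    using x y by (simp add: field_simps)
  moreover have "b * d \<noteq> 0" "\<not> int p dvd b * d"
    using x y assms(1) by (simp_all add: prime_dvd_mult_iff)
  ultimately show ?thesis unfolding p_integers_def by blast
qed

lemma p_integers_sum:
  assumes "prime p" "\<And>k. k \<in> A \<Longrightarrow> f k \<in> p_integers p"
  shows "sum f A \<in> p_integers p"
  using assms(2)
proof (induction A rule: infinite_finite_induct)
  case (insert x F)
  then show ?case using assms(1) by (simp add: p_integers_add)
qed (use of_int_in_p_integers[OF assms(1), of 0] in auto)

text \<open>Both sides satisfy first-order recurrences in \<open>j\<close>: passing to
  \<open>j + 1\<close> multiplies the left side by \<open>(4 * j + 2) / (j + 1)\<close> and the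
  right side by \<open>- 4 * (n - j) / (j + 1)\<close>. The numerators agree modulo
  \<open>2 * n + 1\<close>, and \<open>j + 1\<close> is invertible there.\<close>

lemma central_binomial_cong:
  fixes n j :: nat
  assumes "prime (2 * n + 1)" "j \<le> n"
  shows "[int ((2 * j) choose j) = (- 4) ^ j * int (n choose j)] (mod int (2 * n + 1))"
  using assms(2)
proof (induction j)
  case 0
  then show ?case by simp
next
  case (Suc j)
  let ?p = "int (2 * n + 1)"
  have IH: "[int ((2 * j) choose j) = (- 4) ^ j * int (n choose j)] (mod ?p)"
    using Suc by simp
  have central: "int (Suc j) * int ((2 * Suc j) choose Suc j) = (4 * int j + 2) * int ((2 * j) choose j)"
  proof -
    have "Suc j * ((2 * Suc j) choose Suc j) = 2 * Suc j * (Suc (2 * j) choose j)"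
      using Suc_times_binomial_eq[of "Suc (2 * j)" j] by (simp add: mult.commute)
    moreover have "Suc j * (Suc (2 * j) choose j) = Suc (2 * j) * ((2 * j) choose j)"
      using binomial_absorb_comp[of "Suc (2 * j)" j] by (simp add: Suc_diff_le)
    ultimately have "Suc j * ((2 * Suc j) choose Suc j) = (4 * j + 2) * ((2 * j) choose j)"
      by simp
    then have "int (Suc j * ((2 * Suc j) choose Suc j)) = int ((4 * j + 2) * ((2 * j) choose j))"
      by (rule arg_cong)
    then show ?thesis by (simp only: of_nat_mult of_nat_add of_nat_numeral)
  qed
  have absorb: "int (Suc j) * int (n choose Suc j) = (int n - int j) * int (n choose j)"
  proof -
    have "Suc j * (n choose Suc j) = (n - j) * (n choose j)"
      using binomial_absorption[of j n] binomial_absorb_comp[of n j] by simp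
    then have "int (Suc j * (n choose Suc j)) = int ((n - j) * (n choose j))"
      by (rule arg_cong)
    then show ?thesis using Suc.prems by (simp only: of_nat_mult of_nat_diff Suc_leD)
  qed
  \<comment> \<open>The two sides differ by \<open>2 * (2 * n + 1)\<close> up to sign, whence the
    witness \<open>- 2\<close>.\<close>
  have "[4 * int j + 2 = - 4 * (int n - int j)] (mod ?p)"
    by (rule cong_sym, simp add: cong_iff_dvd_diff algebra_simps) (rule dvdI[of _ _ "- 2"], simp)
  from cong_mult[OF this IH]
  have "[int (Suc j) * int ((2 * Suc j) choose Suc j)
       = - 4 * (int n - int j) * ((- 4) ^ j * int (n choose j))] (mod ?p)"
    unfolding central .
  also have "- 4 * (int n - int j) * ((- 4) ^ j * int (n choose j))
       = (- 4) ^ Suc j * ((int n - int j) * int (n choose j))"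
    by (simp only: power_Suc mult_ac)
  also have "\<dots> = int (Suc j) * ((- 4) ^ Suc j * int (n choose Suc j))"
    unfolding absorb[symmetric] by (rule mult.left_commute)
  finally have "[int (Suc j) * int ((2 * Suc j) choose Suc j)
       = int (Suc j) * ((- 4) ^ Suc j * int (n choose Suc j))] (mod ?p)" .
  \<comment> \<open>Since \<open>0 < Suc j \<le> n < 2 * n + 1\<close>, the prime cannot divide
    \<open>Suc j\<close>, so this factor cancels.\<close>
  moreover have "coprime (int (Suc j)) ?p"
  proof -
    have "\<not> 2 * n + 1 dvd Suc j"
      using Suc.prems by (auto dest: dvd_imp_le)
    then have "coprime (2 * n + 1) (Suc j)"
      using assms(1) prime_imp_coprime by blast
    then show ?thesis by (simp only: coprime_int_iff coprime_commute)
  qed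
  ultimately show ?case
    by (simp only: cong_mult_lcancel)
qed

text \<open>In the binomial expansion of \<open>(1 + \<i>) ^ n\<close> the odd powers of
  \<open>\<i>\<close> are purely imaginary, while \<open>\<i> ^ (2 * k) = (- 1) ^ k\<close>.\<close>

lemma alternating_even_binomial_sum:
  fixes n :: nat
  shows "real_of_int (\<Sum>k = 0..n div 2. (- 1) ^ k * int (n choose (2 * k))) = Re ((1 + \<i>) ^ n)"
proof -
  have even_term: "Re (of_nat (n choose (2 * k)) * \<i> ^ (2 * k)) = (- 1) ^ k * real (n choose (2 * k))" for k
  proof -
    have "\<i> ^ (2 * k) = of_real ((- 1) ^ k)" by (simp add: power_mult)
    then have "of_nat (n choose (2 * k)) * \<i> ^ (2 * k) = of_real ((- 1) ^ k * real (n choose (2 * k)))"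
      by simp
    then show ?thesis by (simp only: Re_complex_of_real)
  qed
  have odd_term: "Re (of_nat (n choose j) * \<i> ^ j) = 0" if "odd j" for j
  proof -
    obtain k where "j = 2 * k + 1" using \<open>odd j\<close> by (rule oddE)
    then have "\<i> ^ j = of_real ((- 1) ^ k) * \<i>" by (simp add: power_add power_mult)
    then show ?thesis by (simp del: of_real_power)
  qed
  have "Re ((1 + \<i>) ^ n) = (\<Sum>j\<le>n. Re (of_nat (n choose j) * \<i> ^ j))"
    by (subst add.commute, subst binomial_ring) simp
  also have "\<dots> = (\<Sum>j \<in> (*) 2 ` {0..n div 2}. Re (of_nat (n choose j) * \<i> ^ j))"
  proof (rule sum.mono_neutral_right)
    show "\<forall>j\<in>{..n} - (*) 2 ` {0..n div 2}. Re (of_nat (n choose j) * \<i> ^ j) = 0"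
    proof
      fix j assume j: "j \<in> {..n} - (*) 2 ` {0..n div 2}"
      then have "odd j" by (auto elim!: evenE)
      then show "Re (of_nat (n choose j) * \<i> ^ j) = 0" by (rule odd_term)
    qed
  qed auto
  also have "\<dots> = (\<Sum>k = 0..n div 2. (- 1) ^ k * real (n choose (2 * k)))"
    by (subst sum.reindex) (simp_all only: inj_on_def comp_def even_term, auto)
  finally show ?thesis by simp
qed

lemma one_plus_ii_power_4: "(1 + \<i>) ^ (4 * m + r) = of_real ((- 4) ^ m) * (1 + \<i>) ^ r"
proof -
  have "(1 + \<i>) ^ 4 = - 4"
    by (simp add: eval_nat_numeral algebra_simps)
  then show ?thesis by (simp add: power_add power_mult)
qed

text \<open>Each full block of four factors \<open>1 + \<i>\<close> contributes \<open>- 4\<close>;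
  the remaining powers with exponents 0, 1, 2, 3 have real parts 1, 1, 0, -2.\<close>

lemma alternating_even_binomial_sum_mod4:
  fixes m :: nat
  defines "T \<equiv> \<lambda>n. \<Sum>k = 0..n div 2. (- 1) ^ k * int (n choose (2 * k))"
  shows "T (4 * m) = (- 4) ^ m" "T (4 * m + 1) = (- 4) ^ m"
    "T (4 * m + 2) = 0" "T (4 * m + 3) = - 2 * (- 4) ^ m"
proof -
  have T: "real_of_int (T (4 * m + r)) = (- 4) ^ m * Re ((1 + \<i>) ^ r)" for r
    unfolding T_def alternating_even_binomial_sum one_plus_ii_power_4 by simp
  have "real_of_int (T (4 * m)) = real_of_int ((- 4) ^ m)"
    using T[of 0] by simp
  then show "T (4 * m) = (- 4) ^ m" by linarith
  have "real_of_int (T (4 * m + 1)) = real_of_int ((- 4) ^ m)"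
    using T[of 1] by simp
  then show "T (4 * m + 1) = (- 4) ^ m" by linarith
  show "T (4 * m + 2) = 0"
    using T[of 2] by (simp add: power2_eq_square)
  have "real_of_int (T (4 * m + 3)) = real_of_int (- 2 * (- 4) ^ m)"
    using T[of 3] by (simp add: eval_nat_numeral)
  then show "T (4 * m + 3) = - 2 * (- 4) ^ m" by linarith
qed

text \<open>The congruence holds term by term: \<open>central_binomial_cong\<close> at
  \<open>j = 2 * k\<close> gives the factor \<open>(- 4) ^ (2 * k) = 16 ^ k\<close>, and dividing by
  the unit \<open>(- 16) ^ k\<close> leaves the sign \<open>(- 1) ^ k\<close>.\<close>

lemma sum_binomial_4k_2k_cong:
  fixes n :: nat
  assumes "prime (2 * n + 1)"
  shows "[(\<Sum>k = 0..n div 2. of_nat ((4 * k) choose (2 * k)) / (- 16) ^ k)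
    \<equiv> of_int (\<Sum>k = 0..n div 2. (- 1) ^ k * int (n choose (2 * k)))] (mod\<^sub>\<rat> (2 * n + 1))"
proof -
  let ?p = "2 * n + 1"
  \<comment> \<open>An odd prime divides no power of 16, so the denominators are units of the local
    ring.\<close>
  have not_dvd: "\<not> int ?p dvd (- 16) ^ k" for k
  proof
    assume "int ?p dvd (- 16) ^ k"
    moreover have "prime (int ?p)" using assms by (simp only: prime_nat_int_transfer)
    ultimately have "int ?p dvd - 16" using prime_dvd_power by blast
    then have "int ?p dvd int (2 ^ 4)" by simp
    then have "?p dvd 2 ^ 4" by (simp only: int_dvd_int_iff)
    with assms have "?p dvd 2" by (rule prime_dvd_power)
    then have "?p \<le> 2" by (rule dvd_imp_le) simp
    with assms show False by (cases n) auto
  qed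
  have frac: "of_int a / (- 16) ^ k \<in> p_integers ?p" for a k
  proof -
    have "of_int a / (- 16) ^ k = of_int a / (of_int ((- 16) ^ k) :: rat)" "(- 16) ^ k \<noteq> (0 :: int)"
      by simp_all
    then show ?thesis unfolding p_integers_def using not_dvd[of k] by blast
  qed
  have "\<exists>c. int ((4 * k) choose (2 * k)) - 16 ^ k * int (n choose (2 * k)) = int ?p * c"
    if "k \<in> {0..n div 2}" for k
  proof -
    have "[int ((2 * (2 * k)) choose (2 * k)) = (- 4) ^ (2 * k) * int (n choose (2 * k))] (mod int ?p)"
      using that by (intro central_binomial_cong[OF assms]) auto
    then show ?thesis
      by (simp add: cong_iff_dvd_diff power_mult dvd_def)
  qed
  \<comment> \<open>Choosing the integer quotients \<open>c k\<close> makes the explicit cofactor of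
    \<open>?p\<close> in the difference of the sums equal to the sum of
    \<open>c k / (- 16) ^ k\<close>.\<close>
  then obtain c where c: "int ((4 * k) choose (2 * k)) - 16 ^ k * int (n choose (2 * k)) = int ?p * c k"
    if "k \<in> {0..n div 2}" for k
    by metis
  have "(\<Sum>k = 0..n div 2. of_nat ((4 * k) choose (2 * k)) / (- 16) ^ k)
      - of_int (\<Sum>k = 0..n div 2. (- 1) ^ k * int (n choose (2 * k)))
      = (\<Sum>k = 0..n div 2. of_nat ((4 * k) choose (2 * k)) / (- 16) ^ k
          - (- 1) ^ k * of_nat (n choose (2 * k)) :: rat)"
    by (simp add: sum_subtractf)
  also have "\<dots> = (\<Sum>k = 0..n div 2. of_nat ?p * (of_int (c k) / (- 16) ^ k))"
  proof (rule sum.cong)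
    fix k assume k: "k \<in> {0..n div 2}"
    have "(of_int (int ((4 * k) choose (2 * k)) - 16 ^ k * int (n choose (2 * k))) :: rat)
        = of_int (int ?p * c k)"
      by (simp only: c[OF k])
    then have eq: "of_nat ((4 * k) choose (2 * k)) - 16 ^ k * of_nat (n choose (2 * k))
        = of_nat ?p * (of_int (c k) :: rat)"
      by simp
    have "(- 1) ^ k * (- 16) ^ k = (16 ^ k :: rat)"
      by (simp flip: power_mult_distrib)
    then have "of_nat ((4 * k) choose (2 * k)) / (- 16) ^ k - (- 1) ^ k * of_nat (n choose (2 * k))
        = (of_nat ((4 * k) choose (2 * k)) - 16 ^ k * of_nat (n choose (2 * k))) / (- 16 :: rat) ^ k"
      by (simp add: field_simps)
    then show "of_nat ((4 * k) choose (2 * k)) / (- 16) ^ k - (- 1) ^ k * of_nat (n choose (2 * k))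
        = of_nat ?p * (of_int (c k) / (- 16 :: rat) ^ k)"
      by (simp only: eq times_divide_eq_right)
  qed simp
  also have "\<dots> = of_nat ?p * (\<Sum>k = 0..n div 2. of_int (c k) / (- 16) ^ k)"
    by (simp only: sum_distrib_left)
  finally have "(\<Sum>k = 0..n div 2. of_nat ((4 * k) choose (2 * k)) / (- 16) ^ k)
      - of_int (\<Sum>k = 0..n div 2. (- 1) ^ k * int (n choose (2 * k)))
      = (of_nat ?p * (\<Sum>k = 0..n div 2. of_int (c k) / (- 16) ^ k) :: rat)" .
  moreover have "(\<Sum>k = 0..n div 2. of_int (c k) / (- 16) ^ k) \<in> p_integers ?p"
    using frac by (intro p_integers_sum[OF assms])
  \<comment> \<open>\<open>rat_cong\<close> also demands that the left-hand sum itself be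
    \<open>p\<close>-integral.\<close>
  moreover have "(\<Sum>k = 0..n div 2. of_nat ((4 * k) choose (2 * k)) / (- 16) ^ k) \<in> p_integers ?p"
    using frac[of "int _"] by (intro p_integers_sum[OF assms]) simp
  ultimately show ?thesis
    unfolding rat_cong_def using of_int_in_p_integers[OF assms] by blast
qed

theorem theorem2p4:
  fixes p :: nat
  assumes "prime p" and "p > 5"
  defines "S \<equiv> (\<Sum>k = 0..p div 4. of_nat ((4 * k) choose (2 * k)) / (- 16) ^ k :: rat)"
  shows "([p = 1] (mod 8) \<longrightarrow> [S \<equiv> (- 1) ^ ((p - 1) div 8) * 2 ^ ((p - 1) div 4)] (mod\<^sub>\<rat> p)) \<and>
         ([p = 3] (mod 8) \<longrightarrow> [S \<equiv> (- 1) ^ ((p - 3) div 8) * 2 ^ ((p - 3) div 4)] (mod\<^sub>\<rat> p)) \<and>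
         ([p = 5] (mod 8) \<longrightarrow> [S \<equiv> 0] (mod\<^sub>\<rat> p)) \<and>
         ([p = 7] (mod 8) \<longrightarrow> [S \<equiv> (- 1) ^ ((p + 1) div 8) * 2 ^ ((p - 3) div 4)] (mod\<^sub>\<rat> p))"
proof -
  define n where "n = p div 2"
  define T where "T = (\<Sum>k = 0..n div 2. (- 1) ^ k * int (n choose (2 * k)))"
  define m where "m = p div 8"
  have "odd p" using assms(1,2) prime_odd_nat by auto
  then have p: "p = 2 * n + 1" by (simp add: n_def)
  \<comment> \<open>Halving twice with rounding equals dividing by 4 with rounding, so both sums
    have the same range.\<close>
  have "p div 4 = n div 2" by (simp add: n_def div_mult2_eq[of p 2 2, simplified])
  then have ST: "[S \<equiv> of_int T] (mod\<^sub>\<rat> p)"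
    using sum_binomial_4k_2k_cong[of n] assms(1) unfolding S_def T_def p[symmetric] by simp
  \<comment> \<open>This separates sign and power of two as in the claim; the residue of
    \<open>p\<close> modulo 8 fixes that of \<open>n\<close> modulo 4, with the same quotient
    \<open>m\<close>.\<close>
  have pow: "(- 4) ^ m = ((- 1) ^ m * 2 ^ (2 * m) :: rat)"
    by (simp add: power_mult flip: power_mult_distrib)
  have "[S \<equiv> (- 1) ^ ((p - 1) div 8) * 2 ^ ((p - 1) div 4)] (mod\<^sub>\<rat> p)" if "[p = 1] (mod 8)"
  proof -
    have pm: "p = 8 * m + 1" using that by (simp add: cong_def m_def) presburger
    then have "n = 4 * m" using p by simp
    then have "T = (- 4) ^ m" unfolding T_def by (simp only: alternating_even_binomial_sum_mod4)
    moreover have "(p - 1) div 8 = m" "(p - 1) div 4 = 2 * m" using pm by auto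
    ultimately show ?thesis using ST pow by simp
  qed
  moreover have "[S \<equiv> (- 1) ^ ((p - 3) div 8) * 2 ^ ((p - 3) div 4)] (mod\<^sub>\<rat> p)" if "[p = 3] (mod 8)"
  proof -
    have pm: "p = 8 * m + 3" using that by (simp add: cong_def m_def) presburger
    then have "n = 4 * m + 1" using p by simp
    then have "T = (- 4) ^ m" unfolding T_def by (simp only: alternating_even_binomial_sum_mod4)
    moreover have "(p - 3) div 8 = m" "(p - 3) div 4 = 2 * m" using pm by auto
    ultimately show ?thesis using ST pow by simp
  qed
  moreover have "[S \<equiv> 0] (mod\<^sub>\<rat> p)" if "[p = 5] (mod 8)"
  proof -
    have pm: "p = 8 * m + 5" using that by (simp add: cong_def m_def) presburger
    then have "n = 4 * m + 2" using p by simp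
    then have "T = 0" unfolding T_def by (simp only: alternating_even_binomial_sum_mod4)
    then show ?thesis using ST by simp
  qed
  moreover have "[S \<equiv> (- 1) ^ ((p + 1) div 8) * 2 ^ ((p - 3) div 4)] (mod\<^sub>\<rat> p)" if "[p = 7] (mod 8)"
  proof -
    have pm: "p = 8 * m + 7" using that by (simp add: cong_def m_def) presburger
    then have "n = 4 * m + 3" using p by simp
    then have "T = - 2 * (- 4) ^ m" unfolding T_def by (simp only: alternating_even_binomial_sum_mod4)
    \<comment> \<open>The extra factor \<open>- 2\<close> raises both exponents by one, which
      accounts for \<open>p + 1\<close> in the sign where the earlier cases have
      \<open>p - 1\<close> or \<open>p - 3\<close>.\<close>
    moreover have "(p + 1) div 8 = Suc m" "(p - 3) div 4 = Suc (2 * m)" using pm by auto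
    ultimately show ?thesis using ST pow by (simp add: mult_ac)
  qed
  ultimately show ?thesis by blast
qed

end
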